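(* Let $X,\tilde X,Y,\tau,f,e,G,g$, the sets $E(t)$, $X(t)$, $Y(t,u^0,u^t)$, $Y(0,u)$ and the one-sided derivatives be as in the context. Assume: (H0) $X(t)\neq\emptyset$ for all $t\in[0,\tau]$. (H1) For all $t\in[0,\tau]$ and all $(u^0,u^t)\in X(0)\times E(t)$: (i) for all $p\in Y$ the mapping $s\mapsto G(t,su^t+(1-s)u^0,p):[0,1]\to\mathbb{R}$ is absolutely continuous; (ii) for all $(\varphi,p)\in X\times Y$ and almost all $s\in(0,1)$ the function $s\mapsto \partial_uG(t,su^t+(1-s)u^0,p)(\varphi):[0,1]\to\mathbb{R}$ is well-defined and belongs to $L_1(0,1)$. (H2) For all $u\in X(0)$ and all $p\in Y(0,u)$ the derivative $\partial_tG(0,u,p)$ exists. (H3) For every null-sequence $(t_n)$ with $t_n\in(0,\tau]$ there exist $u^0\in X(0)$ and $p^0\in Y(0,u^0)$, a subsequence $(t_{n_k})$, elements $(u^0_{t_{n_k}},u^{t_{n_k}})\in E(0)\times X(t_{n_k})$ with $u^{t_{n_k}}-u^0_{t_{n_k}}\in\tilde X$, and $q^{t_{n_k}}\in Y(t_{n_k},u^0_{t_{n_k}},u^{t_{n_k}})$ such that $$\liminf_{k\to\infty}\frac{G(t_{n_k},u^0_{t_{n_k}},q^{t_{n_k}})-G(0,u^0_{t_{n_k}},q^{t_{n_k}})}{t_{n_k}}\ge\partial_tG(0,u^0,p^0).$$ (H4) For every $u^0\in X(0)$ there is a path $t\mapsto\bar u^t:[0,\tau]\to X$ satisfying $\bar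 u^0=u^0$, $\bar u^t-u^0\in\tilde X$, $\bar u^t\in E(t)$ and $\lim_{t\searrow0}\|\bar u^t-u^0\|_X/t^{1/2}=0$, and for all $p^0\in Y(0,u^0)$, $$\limsup_{t\searrow0}\frac{G(t,\bar u^t,p^0)-G(0,\bar u^t,p^0)}{t}\le\partial_tG(0,u^0,p^0).$$ (H5) For every $u^0\in X(0)$ and every $p^0\in Y(0,u^0)$, $$|G(0,u,p^0)-G(0,u^0,p^0)-\partial_uG(0,u^0,p^0)(u-u^0)|=\mathcal{O}(\|u-u^0\|_X^2).$$ Then the one-sided derivative $dg(0):=\lim_{t\searrow0}\frac{g(t)-g(0)}{t}$ exists and there are $u^0\in X(0)$ and $p^0\in Y(0,u^0)$ such that $$dg(0)=\partial_tG(0,u^0,p^0),$$ and we have the bound $$\inf_{u\in X(0)}\inf_{p\in Y(0,u)}\partial_tG(0,u,p)\le dg(0)\le\inf_{u\in X(0)}\sup_{p\in Y(0,u)}\partial_tG(0,u,p).$$ If, in addition, for all $u\in X(0)$ the set $Y(0,u)=\{p^0(u)\}$ is a singleton, then $$dg(0)=\inf_{u\in X(0)}\partial_tG(0,u,p^0(u))=\partial_tG(0,u^0,p^0).$$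
   Context: $X$ is a normed space, $Y$ a vector space, $\tilde X\subset X$ a linear subspace, $\tau>0$. $f:[0,\tau]\times X\to\mathbb{R}$ is a function and $e:[0,\tau]\times X\times Y\to\mathbb{R}$ is a function that is linear in its last argument. The Lagrangian is $G(t,u,q):=f(t,u)+e(t,u,q)$. Set $E(t):=\{u\in X: e(t,u,\varphi)=0\ \text{for all }\varphi\in Y\}$, $g(t):=\inf_{u\in E(t)}f(t,u)$, which is assumed to be finite for all $t\in[0,\tau]$, and $X(t):=\{u\in E(t): f(t,u)=g(t)\}$ (set of minimisers). One-sided derivatives (when the limits exist): $\partial_tG(t,u,p):=\lim_{h\searrow0}\frac{G(t+h,u,p)-G(t,u,p)}{h}$ and $\partial_uG(t,u,p)(v):=\lim_{h\searrow0}\frac{G(t,u+hv,p)-G(t,u,p)}{h}$. For $t\in[0,\tau]$ and $(u^0,u^t)\in E(0)\times E(t)$, $Y(t,u^0,u^t)$ is the set of averaged adjoints, i.e. of all $q\in Y$ with $\int_0^1\partial_uG(t,su^t+(1-s)u^0,q)(\varphi)\,ds=0$ for all $\varphi\in\tilde X$. For $u\in E(0)$, $Y(0,u):=\{p\in Y:\partial_uG(0,u,p)(\varphi)=0\ \text{for all }\varphi\in\tilde X\}=Y(0,u,u)$ is the set of adjoints. A null-sequence is a sequence converging to $0$.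
   Formalization: (H3) additionally requires that G be absolutely continuous along the selected segments for the selected averaged adjoints, and the outer infimum in the upper bound runs only over u in X(0) with Y(0,u) nonempty; without either change the statement is false. *)

theory Defs
  imports "HOL-Analysis.Analysis" "HOL-Library.Landau_Symbols"
begin

text \<open>
  The spaces \<open>X\<close> and \<open>Y\<close> are the types \<open>'a\<close> and \<open>'b\<close>; the subspace \<open>X~\<close> of \<open>X\<close> is a
  set \<open>V\<close>. Functions on \<open>[0,\<tau>]\<close> are total functions on the reals whose values outside
  \<open>[0,\<tau>]\<close> are never used.
\<close>

definition lagrangian ::
  "(real \<Rightarrow> 'a \<Rightarrow> real) \<Rightarrow> (real \<Rightarrow> 'a \<Rightarrow> 'b \<Rightarrow> real) \<Rightarrow> real \<Rightarrow> 'a \<Rightarrow> 'b \<Rightarrow> real" where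
  "lagrangian f e t u q = f t u + e t u q"

definition states :: "(real \<Rightarrow> 'a \<Rightarrow> 'b \<Rightarrow> real) \<Rightarrow> real \<Rightarrow> 'a set" where
  "states e t = {u. \<forall>\<phi>. e t u \<phi> = 0}"

text \<open>The real infimum below is the true one only when it is finite, see \<open>finite_value\<close>.\<close>

definition opt_value ::
  "(real \<Rightarrow> 'a \<Rightarrow> real) \<Rightarrow> (real \<Rightarrow> 'a \<Rightarrow> 'b \<Rightarrow> real) \<Rightarrow> real \<Rightarrow> real" where
  "opt_value f e t = (INF u\<in>states e t. f t u)"

definition finite_value ::
  "(real \<Rightarrow> 'a \<Rightarrow> real) \<Rightarrow> (real \<Rightarrow> 'a \<Rightarrow> 'b \<Rightarrow> real) \<Rightarrow> real \<Rightarrow> bool" where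
  "finite_value f e t \<longleftrightarrow> states e t \<noteq> {} \<and> bdd_below (f t ` states e t)"

definition minimisers ::
  "(real \<Rightarrow> 'a \<Rightarrow> real) \<Rightarrow> (real \<Rightarrow> 'a \<Rightarrow> 'b \<Rightarrow> real) \<Rightarrow> real \<Rightarrow> 'a set" where
  "minimisers f e t = {u \<in> states e t. f t u = opt_value f e t}"

text \<open>
  One-sided derivatives: the predicates say that the limit exists and has the given value,
  the functions return the limit and are only meaningful when it exists.
\<close>

definition has_t_deriv ::
  "(real \<Rightarrow> 'a \<Rightarrow> 'b \<Rightarrow> real) \<Rightarrow> real \<Rightarrow> 'a \<Rightarrow> 'b \<Rightarrow> real \<Rightarrow> bool" where
  "has_t_deriv G t u p d \<longleftrightarrow> ((\<lambda>h. (G (t + h) u p - G t u p) / h) \<longlongrightarrow> d) (at_right 0)"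

definition t_deriv :: "(real \<Rightarrow> 'a \<Rightarrow> 'b \<Rightarrow> real) \<Rightarrow> real \<Rightarrow> 'a \<Rightarrow> 'b \<Rightarrow> real" where
  "t_deriv G t u p = Lim (at_right 0) (\<lambda>h. (G (t + h) u p - G t u p) / h)"

definition has_u_deriv ::
  "(real \<Rightarrow> 'a::real_vector \<Rightarrow> 'b \<Rightarrow> real) \<Rightarrow> real \<Rightarrow> 'a \<Rightarrow> 'b \<Rightarrow> 'a \<Rightarrow> real \<Rightarrow> bool" where
  "has_u_deriv G t u p v d \<longleftrightarrow>
     ((\<lambda>h. (G t (u + h *\<^sub>R v) p - G t u p) / h) \<longlongrightarrow> d) (at_right 0)"

definition u_deriv ::
  "(real \<Rightarrow> 'a::real_vector \<Rightarrow> 'b \<Rightarrow> real) \<Rightarrow> real \<Rightarrow> 'a \<Rightarrow> 'b \<Rightarrow> 'a \<Rightarrow> real" where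
  "u_deriv G t u p v = Lim (at_right 0) (\<lambda>h. (G t (u + h *\<^sub>R v) p - G t u p) / h)"

lemma t_deriv_eqI: "has_t_deriv G t u p d \<Longrightarrow> t_deriv G t u p = d"
  unfolding has_t_deriv_def t_deriv_def by (intro tendsto_Lim) auto

lemma u_deriv_eqI: "has_u_deriv G t u p v d \<Longrightarrow> u_deriv G t u p v = d"
  unfolding has_u_deriv_def u_deriv_def by (intro tendsto_Lim) auto

definition segment_pt :: "'a::real_vector \<Rightarrow> 'a \<Rightarrow> real \<Rightarrow> 'a" where
  "segment_pt u0 u1 s = s *\<^sub>R u1 + (1 - s) *\<^sub>R u0"

text \<open>
  A division is a finite set of compact intervals with pairwise disjoint interiors, and
  the interval \<open>[Inf k, Sup k]\<close> is \<open>k\<close> itself.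
\<close>

definition abs_continuous_on :: "real \<Rightarrow> real \<Rightarrow> (real \<Rightarrow> real) \<Rightarrow> bool" where
  "abs_continuous_on a b h \<longleftrightarrow>
     (\<forall>\<epsilon>>0. \<exists>\<delta>>0. \<forall>D. D division_of \<Union>D \<longrightarrow> \<Union>D \<subseteq> {a..b} \<longrightarrow>
        (\<Sum>k\<in>D. Sup k - Inf k) < \<delta> \<longrightarrow> (\<Sum>k\<in>D. \<bar>h (Sup k) - h (Inf k)\<bar>) < \<epsilon>)"

text \<open>\<open>s \<mapsto> \<partial>\<^sub>uG(t, s u1 + (1-s) u0, p)(\<phi>)\<close> is defined almost everywhere and lies in \<open>L\<^sub>1(0,1)\<close>.\<close>

definition u_deriv_L1 ::
  "(real \<Rightarrow> 'a::real_vector \<Rightarrow> 'b \<Rightarrow> real) \<Rightarrow> real \<Rightarrow> 'a \<Rightarrow> 'a \<Rightarrow> 'b \<Rightarrow> 'a \<Rightarrow> bool" where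
  "u_deriv_L1 G t u0 u1 p \<phi> \<longleftrightarrow>
     (AE s in lebesgue. s \<in> {0<..<1} \<longrightarrow> (\<exists>d. has_u_deriv G t (segment_pt u0 u1 s) p \<phi> d)) \<and>
     set_integrable lebesgue {0<..<1} (\<lambda>s. u_deriv G t (segment_pt u0 u1 s) p \<phi>)"

text \<open>
  That the integrand is defined almost everywhere and integrable is part of being an averaged
  adjoint; otherwise the Bochner integral would be \<open>0\<close> by convention.
\<close>

definition averaged_adjoints ::
  "'a::real_vector set \<Rightarrow> (real \<Rightarrow> 'a \<Rightarrow> 'b \<Rightarrow> real) \<Rightarrow> real \<Rightarrow> 'a \<Rightarrow> 'a \<Rightarrow> 'b set" where
  "averaged_adjoints V G t u0 u1 =
     {q. \<forall>\<phi>\<in>V. u_deriv_L1 G t u0 u1 q \<phi> \<and>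
           (LINT s:{0<..<1}|lebesgue. u_deriv G t (segment_pt u0 u1 s) q \<phi>) = 0}"

definition adjoints ::
  "'a::real_vector set \<Rightarrow> (real \<Rightarrow> 'a \<Rightarrow> 'b \<Rightarrow> real) \<Rightarrow> 'a \<Rightarrow> 'b set" where
  "adjoints V G u = {p. \<forall>\<phi>\<in>V. has_u_deriv G 0 u p \<phi> 0}"

lemma adjoints_eq_averaged_adjoints: "adjoints V G u = averaged_adjoints V G 0 u u"
proof -
  have seg: "segment_pt u u s = u" for s
    by (simp add: segment_pt_def flip: scaleR_add_left)
  have ae: "(AE s in lebesgue. (s::real) \<in> {0<..<1} \<longrightarrow> P) \<longleftrightarrow> P" for P
  proof
    assume *: "AE s in lebesgue. (s::real) \<in> {0<..<1} \<longrightarrow> P"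
    show P
    proof (rule ccontr)
      assume "\<not> P"
      with * have "AE s in lebesgue. (s::real) \<notin> {0<..<1}" by simp
      then have "{0<..<1::real} \<in> null_sets lebesgue"
        using AE_iff_null_sets[of "{0<..<1::real}" lebesgue] by auto
      then have "emeasure lebesgue {0<..<1::real} = 0" by auto
      then show False by simp
    qed
  qed simp
  have "set_integrable lebesgue {0<..<1::real} (\<lambda>s. c)" for c :: real
    unfolding set_integrable_def by (intro integrable_scaleR_left) (auto simp: integrable_indicator_iff)
  moreover have "(LINT s:{0<..<1::real}|lebesgue. c) = c" for c :: real
    by (simp add: set_lebesgue_integral_def)
  ultimately show ?thesis
    unfolding adjoints_def averaged_adjoints_def u_deriv_L1_def seg ae
    by (auto simp: u_deriv_eqI)
qed

end

theory Submission
  imports Defs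
begin

text \<open>
  The difference quotient of the value function \<open>g\<close> is compared with that of the Lagrangian \<open>G\<close>, which
  agrees with the cost on admissible states whatever the multiplier.

  From below: let \<open>w\<close> be a minimiser at time \<open>t\<close>, \<open>v\<close> an admissible state at time \<open>0\<close>, and \<open>q\<close> an
  averaged adjoint for the pair. The derivative of \<open>G\<close> along the segment from \<open>v\<close> to \<open>w\<close> has mean zero, so
  by the fundamental theorem of calculus \<open>g t = G t w q = G t v q\<close>, whereas \<open>g 0 \<le> G 0 v q\<close>. Hence the
  quotient of \<open>g\<close> is at least the quotient of \<open>G\<close> in \<open>t\<close> alone, and along a subsequence of every null
  sequence its lower limit is at least some \<open>\<partial>\<^sub>tG(0, u0, p0)\<close> (\<open>opt_value_lower_quotient\<close>).

  From above: for a minimiser \<open>u0\<close> at time \<open>0\<close> the admissible path \<open>ub\<close> gives \<open>g t \<le> G t (ub t) p0\<close>. Moving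
  from \<open>u0\<close> to \<open>ub t\<close> at time \<open>0\<close> costs only \<open>O(norm (ub t - u0)\<^sup>2) = o(t)\<close>, as the first-order term is
  killed by the adjoint equation. So the upper limit of the quotient is at most \<open>\<partial>\<^sub>tG(0, u0, p0)\<close>, and this
  for \<^emph>\<open>every\<close> minimiser \<open>u0\<close> and adjoint \<open>p0\<close> (\<open>opt_value_upper_quotient\<close>).

  The two bounds together force the quotient to converge to the least of the numbers
  \<open>\<partial>\<^sub>tG(0, u, p)\<close>, which is therefore attained (\<open>tendsto_least_of_subsequential_bounds\<close>). All claims of the
  theorem follow from this description of the limit.

  The analytic ingredient is a fundamental theorem of calculus for absolutely continuous functions in
  which the derivative is only one-sided and exists only almost everywhere
  (\<open>abs_continuous_has_integral_right_derivative\<close>).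
\<close>

section \<open>The fundamental theorem of calculus with one-sided derivatives\<close>

lemma sum_lengths_of_division:
  fixes D :: "real set set"
  assumes D: "D division_of \<Union>D"
  shows "(\<Sum>k\<in>D. Sup k - Inf k) = measure lebesgue (\<Union>D)"
proof -
  have "Sup k - Inf k = measure lebesgue k" if k: "k \<in> D" for k
  proof -
    obtain c d where "k = cbox c d" "k \<noteq> {}"
      using D k by (metis division_ofD(3) division_ofD(4))
    then show ?thesis by auto
  qed
  then have "(\<Sum>k\<in>D. Sup k - Inf k) = (\<Sum>k\<in>D. measure lebesgue k)"
    by (rule sum.cong[OF refl])
  then show ?thesis using content_division[OF D] by simp
qed

lemma abs_continuous_onE:
  assumes "abs_continuous_on a b h" and "\<epsilon> > 0"
  obtains \<delta> where "\<delta> > 0"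
    and "\<And>D. \<lbrakk>D division_of \<Union>D; \<Union>D \<subseteq> {a..b}; (\<Sum>k\<in>D. Sup k - Inf k) < \<delta>\<rbrakk>
              \<Longrightarrow> (\<Sum>k\<in>D. \<bar>h (Sup k) - h (Inf k)\<bar>) < \<epsilon>"
  using assms unfolding abs_continuous_on_def by blast

lemma abs_continuous_on_imp_continuous_on:
  assumes ac: "abs_continuous_on a b h"
  shows "continuous_on {a..b} h"
  unfolding continuous_on_iff
proof (intro ballI allI impI)
  fix x \<epsilon> :: real assume x: "x \<in> {a..b}" and "0 < \<epsilon>"
  then obtain \<delta> where "\<delta> > 0"
    and \<delta>: "\<And>D. \<lbrakk>D division_of \<Union>D; \<Union>D \<subseteq> {a..b}; (\<Sum>k\<in>D. Sup k - Inf k) < \<delta>\<rbrakk>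
              \<Longrightarrow> (\<Sum>k\<in>D. \<bar>h (Sup k) - h (Inf k)\<bar>) < \<epsilon>"
    using abs_continuous_onE[OF ac] by blast
  have close: "\<bar>h v - h u\<bar> < \<epsilon>" if "u \<in> {a..b}" "v \<in> {a..b}" "u \<le> v" "v - u < \<delta>" for u v
    using \<delta>[of "{{u..v}}"] that division_of_self[of u v] by (auto simp: cbox_interval)
  show "\<exists>d>0. \<forall>x'\<in>{a..b}. dist x' x < d \<longrightarrow> dist (h x') (h x) < \<epsilon>"
  proof (intro exI conjI ballI impI)
    fix y assume y: "y \<in> {a..b}" "dist y x < \<delta>"
    show "dist (h y) (h x) < \<epsilon>"
      using close[of x y] close[of y x] x y by (cases "x \<le> y") (auto simp: dist_real_def abs_minus_commute)
  qed fact
qed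

lemma negligible_subset_small_open:
  fixes N :: "real set"
  assumes "negligible N" "\<delta> > 0"
  obtains U where "open U" "N \<subseteq> U" "U \<in> lmeasurable" "measure lebesgue U < \<delta>"
proof -
  have N: "N \<in> null_sets lebesgue"
    using assms(1) by (simp add: negligible_iff_null_sets)
  then obtain U where U: "open U" "N \<subseteq> U" "U - N \<in> lmeasurable" "emeasure lebesgue (U - N) < ennreal \<delta>"
    using sets_lebesgue_outer_open[of N \<delta>] assms(2) by (metis null_setsD2)
  have "emeasure lebesgue U = emeasure lebesgue (U - N)"
    using N U by (simp add: emeasure_Diff_null_set borel_open)
  then have "emeasure lebesgue U < ennreal \<delta>"
    using U by simp
  moreover from this have "U \<in> lmeasurable"
    using U(1) by (intro fmeasurableI) (auto simp: borel_open less_top intro: order.strict_trans)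
  ultimately show ?thesis
    using that U assms(2) by (simp add: emeasure_eq_measure2 ennreal_less_iff)
qed

text \<open>
  Real induction. The supremum of the points of \<open>[a, b]\<close> that satisfy \<open>P\<close> satisfies \<open>P\<close> itself by
  \<open>limit\<close>, so it cannot lie below \<open>b\<close>, as \<open>step\<close> would lead beyond it. \<open>P\<close> need not be inherited by
  smaller points, which is why \<open>limit\<close> supplies only a cofinal supply of points on its left.
\<close>

lemma right_step_induction [consumes 1, case_names base step limit]:
  fixes a b :: real
  assumes "a \<le> b" and "P a"
    and step: "\<And>s. \<lbrakk>a \<le> s; s < b; P s\<rbrakk> \<Longrightarrow> \<exists>s'>s. s' \<le> b \<and> P s'"
    and limit: "\<And>s. \<lbrakk>a < s; s \<le> b; \<And>c. c < s \<Longrightarrow> \<exists>r. c < r \<and> a \<le> r \<and> r < s \<and> P r\<rbrakk> \<Longrightarrow> P s"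
  shows "P b"
proof -
  define S where "S = {s \<in> {a..b}. P s}"
  have "a \<in> S" and bdd: "bdd_above S"
    using assms(1,2) by (auto simp: S_def intro: bdd_aboveI)
  define m where "m = Sup S"
  have le_m: "s \<le> m" if "s \<in> S" for s
    using that bdd by (auto simp: m_def intro: cSup_upper)
  have "m \<le> b"
    using \<open>a \<in> S\<close> unfolding m_def by (intro cSup_least) (auto simp: S_def)
  have "m \<in> S"
  proof (rule ccontr)
    assume "m \<notin> S"
    then have "a < m" using le_m[OF \<open>a \<in> S\<close>] \<open>a \<in> S\<close> by (cases "a = m") auto
    have "\<exists>r. c < r \<and> a \<le> r \<and> r < m \<and> P r" if "c < m" for c
    proof -
      obtain r where "r \<in> S" "c < r"
        using \<open>c < m\<close> less_cSup_iff[OF _ bdd, of c] \<open>a \<in> S\<close> unfolding m_def by blast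
      moreover have "r < m" using le_m[OF \<open>r \<in> S\<close>] \<open>r \<in> S\<close> \<open>m \<notin> S\<close> by (cases "r = m") auto
      ultimately show ?thesis by (auto simp: S_def)
    qed
    then have "P m" using limit[of m] \<open>a < m\<close> \<open>m \<le> b\<close> by blast
    with \<open>m \<notin> S\<close> \<open>a < m\<close> \<open>m \<le> b\<close> show False by (simp add: S_def)
  qed
  then have "a \<le> m" "P m" by (auto simp: S_def)
  have "m = b"
  proof (rule ccontr)
    assume "m \<noteq> b"
    then obtain s' where "m < s'" "s' \<le> b" "P s'"
      using step[of m] \<open>a \<le> m\<close> \<open>P m\<close> \<open>m \<le> b\<close> by force
    with le_m[of s'] \<open>a \<le> m\<close> show False by (simp add: S_def)
  qed
  with \<open>P m\<close> show ?thesis by simp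
qed

lemma tagged_division_extend_right:
  fixes \<phi> :: "real \<Rightarrow> real"
  assumes p: "p tagged_division_of {a..s}" "\<gamma> fine p"
    and "a \<le> s" "s < s'" and x: "x \<in> {s..s'}" "{s..s'} \<subseteq> \<gamma> x"
  shows "insert (x, {s..s'}) p tagged_division_of {a..s'}"
    and "\<gamma> fine insert (x, {s..s'}) p"
    and "(\<Sum>(x,k)\<in>insert (x, {s..s'}) p. measure lborel k *\<^sub>R \<phi> x)
           = (\<Sum>(x,k)\<in>p. measure lborel k *\<^sub>R \<phi> x) + (s' - s) * \<phi> x"
proof -
  have "p \<union> {(x, {s..s'})} tagged_division_of ({a..s} \<union> {s..s'})"
    using x by (intro tagged_division_Un[OF p(1)] tagged_division_of_self_real) auto
  moreover have "{a..s} \<union> {s..s'} = {a..s'}" using assms by auto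
  ultimately show "insert (x, {s..s'}) p tagged_division_of {a..s'}" by simp
  show "\<gamma> fine insert (x, {s..s'}) p"
    using p(2) x(2) by (auto simp: fine_def)
  have "(x, {s..s'}) \<notin> p"
    using tagged_division_ofD(3)[OF p(1), of x "{s..s'}"] \<open>s < s'\<close> by auto
  then show "(\<Sum>(x,k)\<in>insert (x, {s..s'}) p. measure lborel k *\<^sub>R \<phi> x)
           = (\<Sum>(x,k)\<in>p. measure lborel k *\<^sub>R \<phi> x) + (s' - s) * \<phi> x"
    using tagged_division_of_finite[OF p(1)] \<open>s < s'\<close> by simp
qed

lemma division_extend_right:
  fixes D :: "real set set"
  assumes D: "D division_of \<Union>D" "\<Union>D \<subseteq> {a..s}" and "s < s'"
  shows "insert {s..s'} D division_of \<Union>(insert {s..s'} D)" and "{s..s'} \<notin> D"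
proof -
  have "interior (\<Union>D) \<inter> interior {s..s'} = {}"
    using interior_mono[OF D(2)] by auto
  then have "D \<union> {{s..s'}} division_of (\<Union>D \<union> {s..s'})"
    using \<open>s < s'\<close> division_of_self[of s s'] by (intro division_disjoint_union[OF D(1)]) (auto simp: cbox_interval)
  then show "insert {s..s'} D division_of \<Union>(insert {s..s'} D)" by (simp add: Un_commute)
  show "{s..s'} \<notin> D"
  proof
    assume "{s..s'} \<in> D"
    then have "s' \<in> \<Union>D" using \<open>s < s'\<close> by (intro UnionI[of "{s..s'}"]) auto
    with D(2) \<open>s < s'\<close> show False by auto
  qed
qed

text \<open>
  The combinatorial core of the fundamental theorem below. A one-sided derivative controls only the
  intervals whose tag is their left end point, and finitely many of these need not exhaust
  \<open>[a, b]\<close>. Real induction on the right end point closes the gaps: an interval added at a limit point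
  \<open>s\<close> has \<open>s\<close> as its right end point and tag, and continuity alone makes its
  error as small as one likes, though not small against its own length. Hence the separate budget
  \<open>\<eta>\<close>, which is quantified inside the induction: each limit point spends a part of it, and the
  induction hypothesis is used with the rest. At the points of the
  exceptional set \<open>N\<close> nothing is known about \<open>h\<close>; the intervals that start there stay inside \<open>U\<close>, are
  collected in \<open>D\<close>, and the variation of \<open>h\<close> over \<open>D\<close> is left in the bound.
\<close>

lemma approximating_tagged_division:
  fixes h \<phi> :: "real \<Rightarrow> real"
  assumes "a \<le> b" and cont: "continuous_on {a..b} h" and "gauge \<gamma>" and "\<epsilon> > 0"
    and "open U" and N: "N \<subseteq> U" "\<And>s. s \<in> N \<Longrightarrow> \<phi> s = 0"
    and deriv: "\<And>s. s \<in> {a..<b} - N \<Longrightarrow> ((\<lambda>r. (h (s + r) - h s) / r) \<longlongrightarrow> \<phi> s) (at_right 0)"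
    and "\<eta> > 0"
  shows "\<exists>p D. p tagged_division_of {a..b} \<and> \<gamma> fine p \<and> D division_of \<Union>D \<and> \<Union>D \<subseteq> U \<inter> {a..b} \<and>
           \<bar>h b - h a - (\<Sum>(x,k)\<in>p. measure lborel k *\<^sub>R \<phi> x)\<bar>
             \<le> \<epsilon> * (b - a) + \<eta> + (\<Sum>k\<in>D. \<bar>h (Sup k) - h (Inf k)\<bar>)"
proof -
  define R where "R = (\<lambda>p :: (real \<times> real set) set. \<Sum>(x,k)\<in>p. measure lborel k *\<^sub>R \<phi> x)"
  define var where "var = (\<lambda>D :: real set set. \<Sum>k\<in>D. \<bar>h (Sup k) - h (Inf k)\<bar>)"
  define good where "good = (\<lambda>s \<eta> p D. p tagged_division_of {a..s} \<and> \<gamma> fine p \<and>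
    D division_of \<Union>D \<and> \<Union>D \<subseteq> U \<inter> {a..s} \<and> \<bar>h s - h a - R p\<bar> \<le> \<epsilon> * (s - a) + \<eta> + var D)"
  have near: "\<exists>\<rho>>0. \<forall>y. \<bar>y - s\<bar> < \<rho> \<longrightarrow> y \<in> \<gamma> s" for s
  proof -
    have "open (\<gamma> s)" "s \<in> \<gamma> s" using \<open>gauge \<gamma>\<close> by (auto simp: gauge_def)
    then show ?thesis unfolding open_dist by (auto simp: dist_real_def)
  qed
  have goodI: "good s \<eta> p D"
    if "p tagged_division_of {a..s}" "\<gamma> fine p" "D division_of \<Union>D" "\<Union>D \<subseteq> U \<inter> {a..s}"
      "\<bar>h s - h a - R p\<bar> \<le> \<epsilon> * (s - a) + \<eta> + var D" for s \<eta> p D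
    using that by (simp add: good_def)
  have goodD: "p tagged_division_of {a..s}" "\<gamma> fine p" "D division_of \<Union>D" "\<Union>D \<subseteq> U" "\<Union>D \<subseteq> {a..s}"
      "\<bar>h s - h a - R p\<bar> \<le> \<epsilon> * (s - a) + \<eta> + var D" if "good s \<eta> p D" for s \<eta> p D
    using that by (simp_all add: good_def)
  from \<open>a \<le> b\<close> have "\<forall>\<eta>>0. \<exists>p D. good b \<eta> p D"
  proof (induction rule: right_step_induction)
    case base
    have "good a \<eta> {(a, {a..a})} {}" if "\<eta> > 0" for \<eta>
      using that tagged_division_of_self_real[of a a a] \<open>gauge \<gamma>\<close>
      by (auto simp: good_def R_def var_def fine_def gauge_def)
    then show ?case by blast
  next
    case (step s)
    obtain \<rho> where \<rho>: "\<rho> > 0" "\<And>y. \<bar>y - s\<bar> < \<rho> \<Longrightarrow> y \<in> \<gamma> s" using near by blast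
    show ?case
    proof (cases "s \<in> N")
      case True
      obtain \<rho>' where \<rho>': "\<rho>' > 0" "\<And>y. \<bar>y - s\<bar> < \<rho>' \<Longrightarrow> y \<in> U"
        using \<open>open U\<close> True N(1) unfolding open_dist dist_real_def by blast
      define s' where "s' = Min {b, s + \<rho>/2, s + \<rho>'/2}"
      have s': "s < s'" "s' \<le> b" "s' < s + \<rho>" "s' < s + \<rho>'"
        using \<rho>(1) \<rho>'(1) step(2) by (auto simp: s'_def min_def)
      have "\<exists>p D. good s' \<eta> p D" if "\<eta> > 0" for \<eta>
      proof -
        obtain p D where pD: "good s \<eta> p D" using step(3) \<open>\<eta> > 0\<close> by blast
        note old = goodD[OF pD]
        note D' = division_extend_right[OF old(3,5) s'(1)]
        have "finite D" using old(3) by (rule division_of_finite)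
        have sub: "{s..s'} \<subseteq> \<gamma> s" "{s..s'} \<subseteq> U"
          using \<rho>(2) \<rho>'(2) s' by (auto intro!: subsetI)
        have "s \<in> {s..s'}" using s'(1) by simp
        note p' = tagged_division_extend_right[OF old(1,2) step(1) s'(1) this sub(1)]
        have var: "var (insert {s..s'} D) = \<bar>h s' - h s\<bar> + var D"
          using D'(2) \<open>finite D\<close> s'(1) by (simp add: var_def)
        \<comment> \<open>The Riemann sum does not move, so \<open>D\<close> absorbs the whole increment of \<open>h\<close>.\<close>
        have R: "R (insert (s, {s..s'}) p) = R p"
          unfolding R_def p'(3)[of \<phi>] N(2)[OF True] by simp
        have mono: "\<epsilon> * (s - a) \<le> \<epsilon> * (s' - a)" using s'(1) \<open>\<epsilon> > 0\<close> by simp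
        have "good s' \<eta> (insert (s, {s..s'}) p) (insert {s..s'} D)"
        proof (rule goodI[OF p'(1,2) D'(1)])
          show "\<Union>(insert {s..s'} D) \<subseteq> U \<inter> {a..s'}"
            using old(4,5) sub(2) s'(1) step(1) by force
          show "\<bar>h s' - h a - R (insert (s, {s..s'}) p)\<bar> \<le> \<epsilon> * (s' - a) + \<eta> + var (insert {s..s'} D)"
            unfolding R var using old(6) mono by linarith
        qed
        then show ?thesis by blast
      qed
      with s' show ?thesis by blast
    next
      case False
      have "eventually (\<lambda>r. \<bar>(h (s + r) - h s) / r - \<phi> s\<bar> < \<epsilon>) (at_right 0)"
        using tendstoD[OF deriv \<open>\<epsilon> > 0\<close>, of s] False step by (simp add: dist_real_def)
      then obtain \<rho>' where \<rho>': "\<rho>' > 0" "\<And>r. \<lbrakk>0 < r; r < \<rho>'\<rbrakk> \<Longrightarrow> \<bar>(h (s + r) - h s) / r - \<phi> s\<bar> < \<epsilon>"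
        unfolding eventually_at_right_field by auto
      define s' where "s' = Min {b, s + \<rho>/2, s + \<rho>'/2}"
      have s': "s < s'" "s' \<le> b" "s' < s + \<rho>" "s' - s < \<rho>'"
        using \<rho>(1) \<rho>'(1) step(2) by (auto simp: s'_def min_def)
      have err: "\<bar>h s' - h s - (s' - s) * \<phi> s\<bar> \<le> \<epsilon> * (s' - s)"
      proof -
        have "\<bar>(h s' - h s) / (s' - s) - \<phi> s\<bar> * (s' - s) \<le> \<epsilon> * (s' - s)"
          using \<rho>'(2)[of "s' - s"] s' by (intro mult_right_mono) auto
        moreover have "\<bar>(h s' - h s) / (s' - s) - \<phi> s\<bar> * (s' - s)
                     = \<bar>((h s' - h s) / (s' - s) - \<phi> s) * (s' - s)\<bar>"
          using s'(1) by (simp add: abs_mult)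
        moreover have "((h s' - h s) / (s' - s) - \<phi> s) * (s' - s) = h s' - h s - (s' - s) * \<phi> s"
          using s'(1) by (subst left_diff_distrib) simp
        ultimately show ?thesis by simp
      qed
      have "\<exists>p D. good s' \<eta> p D" if "\<eta> > 0" for \<eta>
      proof -
        obtain p D where pD: "good s \<eta> p D" using step(3) \<open>\<eta> > 0\<close> by blast
        note old = goodD[OF pD]
        have sub: "{s..s'} \<subseteq> \<gamma> s" using \<rho>(2) s' by (auto intro!: subsetI)
        have "s \<in> {s..s'}" using s'(1) by simp
        note p' = tagged_division_extend_right[OF old(1,2) step(1) s'(1) this sub]
        have R: "R (insert (s, {s..s'}) p) = R p + (s' - s) * \<phi> s"
          unfolding R_def p'(3)[of \<phi>] ..
        have split: "\<epsilon> * (s' - a) = \<epsilon> * (s - a) + \<epsilon> * (s' - s)" by (simp add: algebra_simps)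
        have "good s' \<eta> (insert (s, {s..s'}) p) D"
        proof (rule goodI[OF p'(1,2) old(3)])
          show "\<Union>D \<subseteq> U \<inter> {a..s'}" using old(4,5) s'(1) by force
          show "\<bar>h s' - h a - R (insert (s, {s..s'}) p)\<bar> \<le> \<epsilon> * (s' - a) + \<eta> + var D"
            unfolding R split using old(6) err by linarith
        qed
        then show ?thesis by blast
      qed
      with s' show ?thesis by blast
    qed
  next
    case (limit s)
    show ?case
    proof (intro allI impI)
      fix \<eta> :: real assume "\<eta> > 0"
      obtain \<rho> where \<rho>: "\<rho> > 0" "\<And>y. \<bar>y - s\<bar> < \<rho> \<Longrightarrow> y \<in> \<gamma> s" using near by blast
      have "continuous_on {a..b} (\<lambda>r. h s - h r - (s - r) * \<phi> s)"
        using cont by (intro continuous_intros)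
      then obtain \<rho>' where \<rho>': "\<rho>' > 0"
        "\<And>r. \<lbrakk>r \<in> {a..b}; \<bar>r - s\<bar> < \<rho>'\<rbrakk> \<Longrightarrow> \<bar>h s - h r - (s - r) * \<phi> s\<bar> < \<eta>/2"
        unfolding continuous_on_iff dist_real_def
        using limit(1,2) \<open>\<eta> > 0\<close> by (metis (no_types, lifting) atLeastAtMost_iff diff_self diff_zero half_gt_zero less_imp_le mult_zero_left)
      define c where "c = max (s - \<rho>) (s - \<rho>')"
      have "c < s" using \<rho>(1) \<rho>'(1) by (simp add: c_def)
      then obtain r where r: "c < r" "a \<le> r" "r < s" and Pr: "\<forall>\<eta>>0. \<exists>p D. good r \<eta> p D"
        using limit(3) by blast
      \<comment> \<open>One half of the budget for the division of \<open>[a, r]\<close>, the other for the last interval.\<close>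
      obtain p D where pD: "good r (\<eta>/2) p D" using Pr \<open>\<eta> > 0\<close> half_gt_zero by blast
      note old = goodD[OF pD]
      have sub: "{r..s} \<subseteq> \<gamma> s" using \<rho>(2) r(1) by (auto simp: c_def intro!: subsetI)
      have "s \<in> {r..s}" using r(3) by simp
      note p' = tagged_division_extend_right[OF old(1,2) r(2,3) this sub]
      have err: "\<bar>h s - h r - (s - r) * \<phi> s\<bar> < \<eta>/2"
        using \<rho>'(2)[of r] r limit(2) by (simp add: c_def)
      have R: "R (insert (s, {r..s}) p) = R p + (s - r) * \<phi> s"
        unfolding R_def p'(3)[of \<phi>] ..
      have mono: "\<epsilon> * (r - a) \<le> \<epsilon> * (s - a)" using r(3) \<open>\<epsilon> > 0\<close> by simp
      have "good s \<eta> (insert (s, {r..s}) p) D"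
      proof (rule goodI[OF p'(1,2) old(3)])
        show "\<Union>D \<subseteq> U \<inter> {a..s}" using old(4,5) r(3) by force
        show "\<bar>h s - h a - R (insert (s, {r..s}) p)\<bar> \<le> \<epsilon> * (s - a) + \<eta> + var D"
          unfolding R using old(6) err mono by linarith
      qed
      then show "\<exists>p D. good s \<eta> p D" by blast
    qed
  qed
  with \<open>\<eta> > 0\<close> show ?thesis unfolding good_def R_def var_def by blast
qed

text \<open>
  Approximate the gauge integral of \<open>\<phi>\<close>, set to \<open>0\<close> on \<open>N\<close>, by the Riemann sums just built. The part
  of \<open>[a, b]\<close> covered by \<open>D\<close> lies in an open set of small measure around \<open>N\<close>, so absolute continuity
  makes the variation of \<open>h\<close> over \<open>D\<close> negligible. The direct use of gauge sums avoids Lebesgue's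
  differentiation theorem.
\<close>

proposition abs_continuous_has_integral_right_derivative:
  fixes h \<phi> :: "real \<Rightarrow> real"
  assumes "a \<le> b" and ac: "abs_continuous_on a b h"
    and "negligible N"
    and deriv: "\<And>s. s \<in> {a..<b} - N \<Longrightarrow> ((\<lambda>r. (h (s + r) - h s) / r) \<longlongrightarrow> \<phi> s) (at_right 0)"
    and int: "(\<phi> has_integral I) {a..b}"
  shows "h b - h a = I"
proof -
  define \<psi> where "\<psi> = (\<lambda>s. if s \<in> N then 0 else \<phi> s)"
  have int': "(\<psi> has_integral I) {a..b}"
    by (rule has_integral_spike[OF \<open>negligible N\<close> _ int]) (simp add: \<psi>_def)
  \<comment> \<open>The three extra \<open>\<epsilon>\<close> are the budget \<open>\<eta>\<close>, the variation over \<open>D\<close>, and the error of the Riemann sum.\<close>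
  have "\<bar>h b - h a - I\<bar> \<le> \<epsilon> * (b - a + 3)" if "\<epsilon> > 0" for \<epsilon>
  proof -
    obtain \<gamma> where "gauge \<gamma>" and \<gamma>: "\<And>p. \<lbrakk>p tagged_division_of {a..b}; \<gamma> fine p\<rbrakk>
        \<Longrightarrow> \<bar>(\<Sum>(x,k)\<in>p. measure lborel k *\<^sub>R \<psi> x) - I\<bar> < \<epsilon>"
      using int' \<open>\<epsilon> > 0\<close> unfolding has_integral_real real_norm_def by metis
    obtain \<delta> where "\<delta> > 0"
      and \<delta>: "\<And>D. \<lbrakk>D division_of \<Union>D; \<Union>D \<subseteq> {a..b}; (\<Sum>k\<in>D. Sup k - Inf k) < \<delta>\<rbrakk>
                \<Longrightarrow> (\<Sum>k\<in>D. \<bar>h (Sup k) - h (Inf k)\<bar>) < \<epsilon>"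
      using abs_continuous_onE[OF ac \<open>\<epsilon> > 0\<close>] by blast
    obtain U where U: "open U" "N \<subseteq> U" "U \<in> lmeasurable" "measure lebesgue U < \<delta>"
      using negligible_subset_small_open[OF \<open>negligible N\<close> \<open>\<delta> > 0\<close>] .
    have deriv': "((\<lambda>r. (h (s + r) - h s) / r) \<longlongrightarrow> \<psi> s) (at_right 0)" if "s \<in> {a..<b} - N" for s
      using deriv[OF that] that by (simp add: \<psi>_def)
    have \<psi>0: "\<psi> s = 0" if "s \<in> N" for s using that by (simp add: \<psi>_def)
    obtain p D where p: "p tagged_division_of {a..b}" "\<gamma> fine p"
      and D: "D division_of \<Union>D" "\<Union>D \<subseteq> U \<inter> {a..b}"
      and err: "\<bar>h b - h a - (\<Sum>(x,k)\<in>p. measure lborel k *\<^sub>R \<psi> x)\<bar>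
             \<le> \<epsilon> * (b - a) + \<epsilon> + (\<Sum>k\<in>D. \<bar>h (Sup k) - h (Inf k)\<bar>)"
      using approximating_tagged_division[OF \<open>a \<le> b\<close> abs_continuous_on_imp_continuous_on[OF ac]
          \<open>gauge \<gamma>\<close> \<open>\<epsilon> > 0\<close> \<open>open U\<close> \<open>N \<subseteq> U\<close> \<psi>0 deriv' \<open>\<epsilon> > 0\<close>]
      by blast
    have "measure lebesgue (\<Union>D) \<le> measure lebesgue U"
      using D U(3) by (intro measure_mono_fmeasurable) (auto intro!: fmeasurableD lmeasurable_division)
    then have "(\<Sum>k\<in>D. \<bar>h (Sup k) - h (Inf k)\<bar>) < \<epsilon>"
      using D U(4) by (intro \<delta>) (auto simp: sum_lengths_of_division)
    moreover have "\<epsilon> * (b - a + 3) = \<epsilon> * (b - a) + 3 * \<epsilon>" by (simp add: algebra_simps)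
    ultimately show ?thesis
      using err \<gamma>[OF p] by linarith
  qed
  then have "\<bar>h b - h a - I\<bar> \<le> 0 + \<epsilon>" if "\<epsilon> > 0" for \<epsilon>
    using \<open>a \<le> b\<close> that
    by (metis (no_types, opaque_lifting) add_0 add_nonneg_pos diff_ge_0_iff_ge divide_pos_pos less_numeral_extra(3) nonzero_divide_eq_eq zero_less_numeral)
  then have "\<bar>h b - h a - I\<bar> \<le> 0" by (rule field_le_epsilon)
  then show ?thesis by simp
qed

section \<open>Comparison of the value function with the Lagrangian\<close>

text \<open>
  The averaged adjoint equation, tested with \<open>u1 - u0\<close>, says that the derivative of the Lagrangian along
  the segment from \<open>u0\<close> to \<open>u1\<close> has integral \<open>0\<close>.
\<close>

lemma averaged_adjoint_imp_lagrangian_eq: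
  assumes q: "q \<in> averaged_adjoints V G t u0 u1" and "u1 - u0 \<in> V"
    and ac: "abs_continuous_on 0 1 (\<lambda>s. G t (segment_pt u0 u1 s) q)"
  shows "G t u1 q = G t u0 q"
proof -
  let ?h = "\<lambda>s. G t (segment_pt u0 u1 s) q"
  let ?\<phi> = "\<lambda>s. u_deriv G t (segment_pt u0 u1 s) q (u1 - u0)"
  have ae: "AE s in lebesgue. s \<in> {0<..<1} \<longrightarrow> (\<exists>d. has_u_deriv G t (segment_pt u0 u1 s) q (u1 - u0) d)"
    and int: "set_integrable lebesgue {0<..<1} ?\<phi>" and zero: "(LINT s:{0<..<1}|lebesgue. ?\<phi> s) = 0"
    using q \<open>u1 - u0 \<in> V\<close> by (auto simp: averaged_adjoints_def u_deriv_L1_def)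
  obtain N where N: "N \<in> null_sets lebesgue"
    "{s. \<not> (s \<in> {0<..<1} \<longrightarrow> (\<exists>d. has_u_deriv G t (segment_pt u0 u1 s) q (u1 - u0) d))} \<subseteq> N"
    using ae unfolding eventually_ae_filter by auto
  have shift: "segment_pt u0 u1 (s + r) = segment_pt u0 u1 s + r *\<^sub>R (u1 - u0)" for s r
    by (simp add: segment_pt_def algebra_simps)
  have "?h 1 - ?h 0 = 0"
  proof (rule abs_continuous_has_integral_right_derivative[OF _ ac])
    \<comment> \<open>Differentiability is known almost everywhere on the open interval, so \<open>0\<close> joins the exceptional set.\<close>
    show "negligible (insert 0 N)"
      using N(1) by (simp add: negligible_iff_null_sets[symmetric] negligible_insert)
    show "(?\<phi> has_integral 0) {0..1}"
      using has_integral_set_lebesgue[OF int] zero by (simp add: has_integral_Icc_iff_Ioo)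
    show "((\<lambda>r. (?h (s + r) - ?h s) / r) \<longlongrightarrow> ?\<phi> s) (at_right 0)" if "s \<in> {0..<1} - insert 0 N" for s
    proof -
      have "s \<in> {0<..<1}" "s \<notin> N" using that by auto
      then obtain d where d: "has_u_deriv G t (segment_pt u0 u1 s) q (u1 - u0) d" using N(2) by blast
      show ?thesis
        unfolding shift u_deriv_eqI[OF d] using d by (simp add: has_u_deriv_def)
    qed
  qed simp
  then show ?thesis by (simp add: segment_pt_def)
qed

text \<open>
  The path \<open>ub\<close> approaches \<open>u0\<close> faster than \<open>t\<^sup>1\<^sup>/\<^sup>2\<close>, so a remainder of second order in
  \<open>ub t - u0\<close> is \<open>o(t)\<close>. The value of \<open>F\<close> at \<open>u0\<close> matters because the path may return to \<open>u0\<close>, where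
  the bound along \<open>at u0\<close> says nothing.
\<close>

lemma bigo_square_along_path:
  fixes F :: "'a::real_normed_vector \<Rightarrow> real"
  assumes F: "F \<in> O[at u0](\<lambda>u. (norm (u - u0))\<^sup>2)" and "F u0 = 0"
    and path: "((\<lambda>t. norm (ub t - u0) / t powr (1/2)) \<longlongrightarrow> 0) (at_right 0)"
  shows "((\<lambda>t. F (ub t) / t) \<longlongrightarrow> 0) (at_right 0)"
proof -
  let ?\<rho> = "\<lambda>t. norm (ub t - u0) / t powr (1/2)"
  obtain C where "eventually (\<lambda>u. norm (F u) \<le> C * norm ((norm (u - u0))\<^sup>2)) (at u0)"
    using landau_o.bigE[OF F] by blast
  then have C: "eventually (\<lambda>u. \<bar>F u\<bar> \<le> C * (norm (u - u0))\<^sup>2) (nhds u0)"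
    using \<open>F u0 = 0\<close> unfolding eventually_at_filter by (auto elim!: eventually_mono)
  have pos: "eventually (\<lambda>t::real. 0 < t) (at_right 0)"
    by (rule eventually_at_right_less)
  have "((\<lambda>t::real. t powr (1/2)) \<longlongrightarrow> 0) (at_right 0)"
    by (rule tendsto_eq_rhs[OF tendsto_zero_powrI]) (auto intro!: tendsto_ident_at eventually_mono[OF pos])
  then have "((\<lambda>t. ?\<rho> t * t powr (1/2)) \<longlongrightarrow> 0) (at_right 0)"
    using tendsto_mult_zero[OF path] by blast
  moreover have "eventually (\<lambda>t. ?\<rho> t * t powr (1/2) = norm (ub t - u0)) (at_right 0)"
    using pos by eventually_elim simp
  ultimately have "((\<lambda>t. norm (ub t - u0)) \<longlongrightarrow> 0) (at_right 0)"
    by (rule Lim_transform_eventually)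
  then have "(ub \<longlongrightarrow> u0) (at_right 0)"
    by (simp add: tendsto_norm_zero_iff LIM_zero_cancel)
  then have "eventually (\<lambda>t. \<bar>F (ub t)\<bar> \<le> C * (norm (ub t - u0))\<^sup>2) (at_right 0)"
    using C by (rule eventually_compose_filterlim[rotated])
  with pos have "eventually (\<lambda>t. norm (F (ub t) / t) \<le> C * (?\<rho> t)\<^sup>2) (at_right 0)"
  proof eventually_elim
    case (elim t)
    have "(t powr (1/2))\<^sup>2 = t" using elim(1) by (simp add: powr_half_sqrt)
    then have "C * (?\<rho> t)\<^sup>2 = C * (norm (ub t - u0))\<^sup>2 / t" by (simp add: power_divide)
    then show ?case using elim by (simp add: divide_right_mono)
  qed
  moreover have "((\<lambda>t. C * (?\<rho> t)\<^sup>2) \<longlongrightarrow> 0) (at_right 0)"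
    using tendsto_mult[OF tendsto_const tendsto_power[OF path, of 2], of C] by simp
  ultimately show ?thesis by (rule Lim_null_comparison)
qed

text \<open>
  On the states of time \<open>t\<close> the constraint term vanishes, so the multiplier \<open>q\<close> may be chosen freely in
  each comparison of the value function with the Lagrangian.
\<close>

lemma lagrangian_on_states: "u \<in> states e t \<Longrightarrow> lagrangian f e t u q = f t u"
  by (simp add: lagrangian_def states_def)

lemma lagrangian_minimiser: "u \<in> minimisers f e t \<Longrightarrow> lagrangian f e t u q = opt_value f e t"
  by (simp add: minimisers_def lagrangian_on_states)

lemma opt_value_le_lagrangian:
  "\<lbrakk>finite_value f e t; u \<in> states e t\<rbrakk> \<Longrightarrow> opt_value f e t \<le> lagrangian f e t u q"
  by (simp add: opt_value_def finite_value_def lagrangian_on_states cINF_lower)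

text \<open>
  The averaged adjoint moves the Lagrangian at time \<open>t\<close> from the minimiser \<open>w\<close> to \<open>v\<close>, which is an
  admissible competitor at time \<open>0\<close>. Only the variation in \<open>t\<close> at the fixed point \<open>v\<close> remains.
\<close>

lemma opt_value_lower_quotient:
  assumes "finite_value f e 0" and "t > 0"
    and v: "v \<in> states e 0" and w: "w \<in> minimisers f e t" "w - v \<in> V"
    and q: "q \<in> averaged_adjoints V (lagrangian f e) t v w"
    and ac: "abs_continuous_on 0 1 (\<lambda>s. lagrangian f e t (segment_pt v w s) q)"
  shows "(lagrangian f e t v q - lagrangian f e 0 v q) / t \<le> (opt_value f e t - opt_value f e 0) / t"
proof -
  have "opt_value f e t = lagrangian f e t v q"
    using averaged_adjoint_imp_lagrangian_eq[OF q w(2) ac] lagrangian_minimiser[OF w(1), of q] by simp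
  moreover have "opt_value f e 0 \<le> lagrangian f e 0 v q"
    using opt_value_le_lagrangian[OF assms(1) v] .
  ultimately show ?thesis using \<open>t > 0\<close> by (simp add: divide_right_mono)
qed

text \<open>
  Here \<open>ub t\<close> is the competitor at time \<open>t\<close>. Going from \<open>(0, u0)\<close> to \<open>(t, ub t)\<close> changes the Lagrangian
  first in \<open>u\<close> and then in \<open>t\<close>. The first change is \<open>o(t)\<close> since the adjoint \<open>p0\<close> annihilates its
  linear part, the direction \<open>ub t - u0\<close> being in \<open>V\<close>; the second is controlled by \<open>d\<close>. The bound holds for
  each adjoint separately, which is what later makes the derivative a minimum over all adjoints.
\<close>

lemma opt_value_upper_quotient:
  fixes f :: "real \<Rightarrow> 'a::real_normed_vector \<Rightarrow> real"
    and e :: "real \<Rightarrow> 'a \<Rightarrow> 'b \<Rightarrow> real"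
  defines "G \<equiv> lagrangian f e"
  assumes "\<tau> > 0" and V: "subspace V"
    and fin: "\<And>t. t \<in> {0..\<tau>} \<Longrightarrow> finite_value f e t"
    and u0: "u0 \<in> minimisers f e 0" and p0: "p0 \<in> adjoints V G u0"
    and ub: "\<And>t. t \<in> {0..\<tau>} \<Longrightarrow> ub t - u0 \<in> V \<and> ub t \<in> states e t"
    and path: "((\<lambda>t. norm (ub t - u0) / t powr (1/2)) \<longlongrightarrow> 0) (at_right 0)"
    and sup: "Limsup (at_right 0) (\<lambda>t. ereal ((G t (ub t) p0 - G 0 (ub t) p0) / t)) \<le> ereal d"
    and rem: "(\<lambda>u. \<bar>G 0 u p0 - G 0 u0 p0 - u_deriv G 0 u0 p0 (u - u0)\<bar>)
            \<in> O[at u0](\<lambda>u. (norm (u - u0))\<^sup>2)"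
    and "d < c"
  shows "eventually (\<lambda>t. (opt_value f e t - opt_value f e 0) / t < c) (at_right 0)"
proof -
  define m where "m = (d + c) / 2"
  have m: "d < m" "c - m > 0" using \<open>d < c\<close> by (simp_all add: m_def)
  define F where "F = (\<lambda>u. \<bar>G 0 u p0 - G 0 u0 p0 - u_deriv G 0 u0 p0 (u - u0)\<bar>)"
  have u_deriv_0: "u_deriv G 0 u0 p0 v = 0" if "v \<in> V" for v
    using p0 that by (auto simp: adjoints_def u_deriv_eqI)
  have "F u0 = 0"
    using u_deriv_0[OF subspace_0[OF V]] by (simp add: F_def)
  then have "((\<lambda>t. F (ub t) / t) \<longlongrightarrow> 0) (at_right 0)"
    using bigo_square_along_path[OF _ _ path] rem unfolding F_def by blast
  then have small: "eventually (\<lambda>t. F (ub t) / t < c - m) (at_right 0)"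
    using m(2) by (rule order_tendstoD)
  have incr: "eventually (\<lambda>t. (G t (ub t) p0 - G 0 (ub t) p0) / t < m) (at_right 0)"
    using sup m(1) unfolding Limsup_le_iff by (auto dest!: spec[of _ "ereal m"])
  have dom: "eventually (\<lambda>t. 0 < t \<and> t < \<tau>) (at_right 0)"
    using \<open>\<tau> > 0\<close> unfolding eventually_at_right_field by blast
  from small incr dom show ?thesis
  proof eventually_elim
    case (elim t)
    then have t: "0 < t" "t \<in> {0..\<tau>}" by auto
    have "opt_value f e t \<le> G t (ub t) p0"
      unfolding G_def using opt_value_le_lagrangian[OF fin[OF t(2)]] ub[OF t(2)] by simp
    moreover have "opt_value f e 0 = G 0 u0 p0"
      unfolding G_def using lagrangian_minimiser[OF u0] by simp
    moreover have "G 0 (ub t) p0 - G 0 u0 p0 \<le> F (ub t)"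
      using u_deriv_0 ub[OF t(2)] by (simp add: F_def)
    ultimately have "(opt_value f e t - opt_value f e 0) / t
        \<le> ((G t (ub t) p0 - G 0 (ub t) p0) + F (ub t)) / t"
      using t(1) by (intro divide_right_mono) auto
    also have "\<dots> = (G t (ub t) p0 - G 0 (ub t) p0) / t + F (ub t) / t"
      by (rule add_divide_distrib)
    also have "\<dots> < m + (c - m)" using elim by (intro add_strict_mono) auto
    finally show ?case by simp
  qed
qed

section \<open>Existence and value of the derivative\<close>

text \<open>
  Take \<open>D\<close> to be the set of candidate values of a limit. Each element of \<open>D\<close> bounds \<open>Q\<close> from above
  asymptotically, while along each null sequence some element of \<open>D\<close> bounds a subsequence from below.
  That element lies below every other one: it is the least element of \<open>D\<close>, hence the same for all null
  sequences, and the upper bound that it gives closes the gap.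
\<close>

lemma tendsto_least_of_subsequential_bounds:
  fixes Q :: "real \<Rightarrow> real"
  assumes "\<tau> > 0"
    and upper: "\<And>d c. \<lbrakk>d \<in> D; d < c\<rbrakk> \<Longrightarrow> eventually (\<lambda>t. Q t < c) (at_right 0)"
    and lower: "\<And>t :: nat \<Rightarrow> real. \<lbrakk>\<And>n. t n \<in> {0<..\<tau>}; t \<longlonglongrightarrow> 0\<rbrakk> \<Longrightarrow>
      \<exists>d\<in>D. \<exists>r. strict_mono r \<and> (\<forall>c<d. eventually (\<lambda>k. c < Q (t (r k))) sequentially)"
  shows "\<exists>d\<in>D. (Q \<longlongrightarrow> d) (at_right 0) \<and> (\<forall>d'\<in>D. d \<le> d')"
proof -
  have least: "\<exists>d\<in>D. (\<forall>d'\<in>D. d \<le> d') \<and> (\<forall>c<d. frequently (\<lambda>n. c < Q (t n)) sequentially)"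
    if t: "\<And>n. t n \<in> {0<..\<tau>}" "t \<longlonglongrightarrow> 0" for t :: "nat \<Rightarrow> real"
  proof -
    obtain d r where "d \<in> D" "strict_mono r"
      and r: "\<And>c. c < d \<Longrightarrow> eventually (\<lambda>k. c < Q (t (r k))) sequentially"
      using lower[OF t] by blast
    have "filterlim t (at_right 0) sequentially"
      using t by (intro tendsto_imp_filterlim_at_right always_eventually) auto
    then have tr: "filterlim (\<lambda>k. t (r k)) (at_right 0) sequentially"
      using filterlim_subseq[OF \<open>strict_mono r\<close>] by (rule filterlim_compose)
    have "d \<le> d'" if "d' \<in> D" for d'
    proof (rule ccontr)
      assume "\<not> d \<le> d'"
      then obtain c where c: "d' < c" "c < d" using dense[of d' d] by auto
      have "eventually (\<lambda>k. Q (t (r k)) < c) sequentially"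
        using upper[OF that c(1)] tr by (rule eventually_compose_filterlim)
      with r[OF c(2)] have "eventually (\<lambda>k. False) sequentially"
        by eventually_elim simp
      then show False by simp
    qed
    moreover have "frequently (\<lambda>n. c < Q (t n)) sequentially" if "c < d" for c
    proof -
      have "frequently (\<lambda>k. c < Q (t (r k))) sequentially"
        using r[OF that] by (simp add: eventually_frequently)
      then show ?thesis
        using eventually_subseq[OF \<open>strict_mono r\<close>, of "\<lambda>n. \<not> c < Q (t n)"]
        unfolding frequently_def by blast
    qed
    ultimately show ?thesis using \<open>d \<in> D\<close> by blast
  qed
  have "(\<lambda>n. \<tau> / real (Suc n)) \<longlonglongrightarrow> 0"
    by (rule LIMSEQ_Suc[OF lim_const_over_n])
  moreover have "\<tau> / real (Suc n) \<in> {0<..\<tau>}" for n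
    using \<open>\<tau> > 0\<close> by (auto simp: field_simps)
  ultimately obtain d where "d \<in> D" and d_le: "\<And>d'. d' \<in> D \<Longrightarrow> d \<le> d'"
    using least[of "\<lambda>n. \<tau> / real (Suc n)"] by blast
  have "(Q \<longlongrightarrow> d) (at_right 0)"
  proof (rule order_tendstoI)
    fix c assume "d < c"
    then show "eventually (\<lambda>t. Q t < c) (at_right 0)" using upper \<open>d \<in> D\<close> by blast
  next
    fix c assume "c < d"
    show "eventually (\<lambda>t. c < Q t) (at_right 0)"
    proof (rule ccontr)
      assume not: "\<not> eventually (\<lambda>t. c < Q t) (at_right 0)"
      have "\<exists>t. t \<in> {0<..\<tau>} \<and> t < 1 / real (Suc n) \<and> Q t \<le> c" for n
      proof -
        have "0 < min \<tau> (1 / real (Suc n))" using \<open>\<tau> > 0\<close> by simp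
        then obtain t where "0 < t" "t < min \<tau> (1 / real (Suc n))" "\<not> c < Q t"
          using not unfolding eventually_at_right_field by blast
        then show ?thesis by (intro exI[of _ t]) auto
      qed
      then obtain t where t: "\<And>n. t n \<in> {0<..\<tau>}" "\<And>n. t n < 1 / real (Suc n)" "\<And>n. Q (t n) \<le> c"
        by metis
      have "t \<longlonglongrightarrow> 0"
      proof (rule tendsto_sandwich[OF _ _ tendsto_const LIMSEQ_Suc[OF lim_const_over_n[of 1]]])
        show "eventually (\<lambda>n. 0 \<le> t n) sequentially"
          using t(1) by (auto intro!: always_eventually simp: less_imp_le)
        show "eventually (\<lambda>n. t n \<le> 1 / real (Suc n)) sequentially"
          using t(2) by (auto intro!: always_eventually less_imp_le)
      qed
      then obtain d1 where "d1 \<in> D" "\<And>c. c < d1 \<Longrightarrow> frequently (\<lambda>n. c < Q (t n)) sequentially"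
        using least[of t] t(1) by blast
      then have "frequently (\<lambda>n. c < Q (t n)) sequentially"
        using d_le \<open>c < d\<close> by (meson less_le_trans)
      then obtain n where "c < Q (t n)" by (auto dest: frequently_ex)
      with t(3)[of n] show False by simp
    qed
  qed
  with \<open>d \<in> D\<close> d_le show ?thesis by blast
qed

theorem theorem2p10:
  fixes f :: "real \<Rightarrow> 'a::real_normed_vector \<Rightarrow> real"
    and e :: "real \<Rightarrow> 'a \<Rightarrow> 'b::real_vector \<Rightarrow> real"
    and V :: "'a set" and \<tau> :: real
    and G :: "real \<Rightarrow> 'a \<Rightarrow> 'b \<Rightarrow> real" and g :: "real \<Rightarrow> real"
    and E M :: "real \<Rightarrow> 'a set"
  defines "G \<equiv> lagrangian f e"
    and "E \<equiv> states e"
    and "M \<equiv> minimisers f e"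
    and "g \<equiv> opt_value f e"
  assumes tau: "\<tau> > 0"
    and V: "subspace V"
    and lin: "\<forall>t\<in>{0..\<tau>}. \<forall>u. linear (e t u)"
    and fin: "\<forall>t\<in>{0..\<tau>}. finite_value f e t"
    and H0: "\<forall>t\<in>{0..\<tau>}. M t \<noteq> {}"
    and H1: "\<forall>t\<in>{0..\<tau>}. \<forall>u0\<in>M 0. \<forall>ut\<in>E t.
          (\<forall>p. abs_continuous_on 0 1 (\<lambda>s. G t (segment_pt u0 ut s) p)) \<and>
          (\<forall>\<phi> p. u_deriv_L1 G t u0 ut p \<phi>)"
    and H2: "\<forall>u\<in>M 0. \<forall>p\<in>adjoints V G u. \<exists>d. has_t_deriv G 0 u p d"
    and H3: "\<forall>t::nat \<Rightarrow> real. (\<forall>n. t n \<in> {0<..\<tau>}) \<and> t \<longlonglongrightarrow> 0 \<longrightarrow>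
          (\<exists>u0\<in>M 0. \<exists>p0\<in>adjoints V G u0. \<exists>r::nat \<Rightarrow> nat. \<exists>v w q. strict_mono r \<and>
             (\<forall>k. v k \<in> E 0 \<and> w k \<in> M (t (r k)) \<and> w k - v k \<in> V \<and>
                  q k \<in> averaged_adjoints V G (t (r k)) (v k) (w k) \<and>
                  abs_continuous_on 0 1 (\<lambda>s. G (t (r k)) (segment_pt (v k) (w k) s) (q k))) \<and>
             liminf (\<lambda>k. ereal ((G (t (r k)) (v k) (q k) - G 0 (v k) (q k)) / t (r k)))
               \<ge> ereal (t_deriv G 0 u0 p0))"
    and H4: "\<forall>u0\<in>M 0. \<exists>ub::real \<Rightarrow> 'a. ub 0 = u0 \<and>
          (\<forall>t\<in>{0..\<tau>}. ub t - u0 \<in> V \<and> ub t \<in> E t) \<and>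
          ((\<lambda>t. norm (ub t - u0) / t powr (1/2)) \<longlongrightarrow> 0) (at_right 0) \<and>
          (\<forall>p0\<in>adjoints V G u0.
             Limsup (at_right 0) (\<lambda>t. ereal ((G t (ub t) p0 - G 0 (ub t) p0) / t))
               \<le> ereal (t_deriv G 0 u0 p0))"
    and H5: "\<forall>u0\<in>M 0. \<forall>p0\<in>adjoints V G u0.
          (\<lambda>u. \<bar>G 0 u p0 - G 0 u0 p0 - u_deriv G 0 u0 p0 (u - u0)\<bar>)
            \<in> O[at u0](\<lambda>u. (norm (u - u0))\<^sup>2)"
  shows "\<exists>dg. ((\<lambda>t. (g t - g 0) / t) \<longlongrightarrow> dg) (at_right 0) \<and>
     (\<exists>u0\<in>M 0. \<exists>p0\<in>adjoints V G u0.
        dg = t_deriv G 0 u0 p0 \<and>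
        (INF u\<in>M 0. INF p\<in>adjoints V G u. ereal (t_deriv G 0 u p)) \<le> ereal dg \<and>
        ereal dg \<le> (INF u\<in>{u \<in> M 0. adjoints V G u \<noteq> {}}.
                       SUP p\<in>adjoints V G u. ereal (t_deriv G 0 u p)) \<and>
        (\<forall>P. (\<forall>u\<in>M 0. adjoints V G u = {P u}) \<longrightarrow>
           ereal dg = (INF u\<in>M 0. ereal (t_deriv G 0 u (P u))) \<and>
           (INF u\<in>M 0. ereal (t_deriv G 0 u (P u))) = ereal (t_deriv G 0 u0 p0)))"
proof -
  \<comment> \<open>The derivative turns out to be the least of all \<open>t_deriv G 0 u p\<close>, which is stronger than both bounds.\<close>
  define D where "D = {t_deriv G 0 u p | u p. u \<in> M 0 \<and> p \<in> adjoints V G u}"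
  have "\<exists>d\<in>D. ((\<lambda>t. (g t - g 0) / t) \<longlongrightarrow> d) (at_right 0) \<and> (\<forall>d'\<in>D. d \<le> d')"
  proof (rule tendsto_least_of_subsequential_bounds[OF tau])
    fix d c assume "d \<in> D" "d < c"
    then obtain u0 p0 where u0: "u0 \<in> M 0" and p0: "p0 \<in> adjoints V G u0" and d: "t_deriv G 0 u0 p0 < c"
      by (auto simp: D_def)
    obtain ub where ub: "\<forall>t\<in>{0..\<tau>}. ub t - u0 \<in> V \<and> ub t \<in> E t"
      and path: "((\<lambda>t. norm (ub t - u0) / t powr (1/2)) \<longlongrightarrow> 0) (at_right 0)"
      and sup: "Limsup (at_right 0) (\<lambda>t. ereal ((G t (ub t) p0 - G 0 (ub t) p0) / t)) \<le> ereal (t_deriv G 0 u0 p0)"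
      using H4 u0 p0 by blast
    have rem: "(\<lambda>u. \<bar>G 0 u p0 - G 0 u0 p0 - u_deriv G 0 u0 p0 (u - u0)\<bar>)
            \<in> O[at u0](\<lambda>u. (norm (u - u0))\<^sup>2)"
      using H5 u0 p0 by blast
    show "eventually (\<lambda>t. (g t - g 0) / t < c) (at_right 0)"
      unfolding g_def
      by (rule opt_value_upper_quotient[OF tau V fin[rule_format] u0[unfolded M_def]
            p0[unfolded G_def] ub[unfolded E_def, rule_format] path sup[unfolded G_def]
            rem[unfolded G_def] d[unfolded G_def]])
  next
    fix t :: "nat \<Rightarrow> real" assume t: "\<And>n. t n \<in> {0<..\<tau>}" "t \<longlonglongrightarrow> 0"
    then obtain u0 p0 r v w q where u0: "u0 \<in> M 0" "p0 \<in> adjoints V G u0" and r: "strict_mono r"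
      and vwq: "\<And>k. v k \<in> E 0" "\<And>k. w k \<in> M (t (r k))" "\<And>k. w k - v k \<in> V"
        "\<And>k. q k \<in> averaged_adjoints V G (t (r k)) (v k) (w k)"
        "\<And>k. abs_continuous_on 0 1 (\<lambda>s. G (t (r k)) (segment_pt (v k) (w k) s) (q k))"
      and inf: "ereal (t_deriv G 0 u0 p0)
        \<le> liminf (\<lambda>k. ereal ((G (t (r k)) (v k) (q k) - G 0 (v k) (q k)) / t (r k)))"
      using H3[rule_format, of t] by blast
    have quot: "(G (t (r k)) (v k) (q k) - G 0 (v k) (q k)) / t (r k) \<le> (g (t (r k)) - g 0) / t (r k)" for k
      unfolding G_def g_def
      using opt_value_lower_quotient[of f e "t (r k)" "v k" "w k" V "q k"] fin tau t(1)[of "r k"] vwq[of k]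
      by (simp add: G_def E_def M_def)
    have "eventually (\<lambda>k. c < (g (t (r k)) - g 0) / t (r k)) sequentially" if "c < t_deriv G 0 u0 p0" for c
    proof -
      have "eventually (\<lambda>k. ereal c < ereal ((G (t (r k)) (v k) (q k) - G 0 (v k) (q k)) / t (r k))) sequentially"
        using inf that unfolding le_Liminf_iff by (auto dest!: spec[of _ "ereal c"])
      then show ?thesis
        by eventually_elim (use quot in \<open>auto intro: less_le_trans\<close>)
    qed
    moreover have "t_deriv G 0 u0 p0 \<in> D"
      using u0 unfolding D_def by blast
    ultimately show "\<exists>d\<in>D. \<exists>r. strict_mono r \<and>
        (\<forall>c<d. eventually (\<lambda>k. c < (g (t (r k)) - g 0) / t (r k)) sequentially)"
      using r by (intro bexI[of _ "t_deriv G 0 u0 p0"] exI[of _ r] conjI) auto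
  qed
  then obtain u0 p0 where u0: "u0 \<in> M 0" and p0: "p0 \<in> adjoints V G u0"
    and lim: "((\<lambda>t. (g t - g 0) / t) \<longlongrightarrow> t_deriv G 0 u0 p0) (at_right 0)"
    and least: "\<And>u p. \<lbrakk>u \<in> M 0; p \<in> adjoints V G u\<rbrakk> \<Longrightarrow> t_deriv G 0 u0 p0 \<le> t_deriv G 0 u p"
    unfolding D_def by blast
  have lower: "(INF u\<in>M 0. INF p\<in>adjoints V G u. ereal (t_deriv G 0 u p)) \<le> ereal (t_deriv G 0 u0 p0)"
    using u0 p0 by (intro INF_lower2[of u0] INF_lower)
  have upper: "ereal (t_deriv G 0 u0 p0)
      \<le> (INF u\<in>{u \<in> M 0. adjoints V G u \<noteq> {}}. SUP p\<in>adjoints V G u. ereal (t_deriv G 0 u p))"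
  proof (rule INF_greatest)
    fix u assume "u \<in> {u \<in> M 0. adjoints V G u \<noteq> {}}"
    then obtain p where "u \<in> M 0" "p \<in> adjoints V G u" by blast
    then show "ereal (t_deriv G 0 u0 p0) \<le> (SUP p\<in>adjoints V G u. ereal (t_deriv G 0 u p))"
      using least by (intro SUP_upper2[of p]) auto
  qed
  have singleton: "(INF u\<in>M 0. ereal (t_deriv G 0 u (P u))) = ereal (t_deriv G 0 u0 p0)"
    if P: "\<forall>u\<in>M 0. adjoints V G u = {P u}" for P
  proof (rule antisym)
    have "P u0 = p0" using P u0 p0 by auto
    then show "(INF u\<in>M 0. ereal (t_deriv G 0 u (P u))) \<le> ereal (t_deriv G 0 u0 p0)"
      using INF_lower[OF u0, of "\<lambda>u. ereal (t_deriv G 0 u (P u))"] by simp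
    show "ereal (t_deriv G 0 u0 p0) \<le> (INF u\<in>M 0. ereal (t_deriv G 0 u (P u)))"
      using least P by (intro INF_greatest) auto
  qed
  show ?thesis
  proof (intro exI[of _ "t_deriv G 0 u0 p0"] conjI bexI[OF _ u0] bexI[OF _ p0] allI impI)
    fix P assume "\<forall>u\<in>M 0. adjoints V G u = {P u}"
    note eq = singleton[OF this]
    from eq show "ereal (t_deriv G 0 u0 p0) = (INF u\<in>M 0. ereal (t_deriv G 0 u (P u)))" by (rule sym)
    from eq show "(INF u\<in>M 0. ereal (t_deriv G 0 u (P u))) = ereal (t_deriv G 0 u0 p0)" .
  qed (use lim lower upper in simp_all)
qed

end
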